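(* Let $m>2$ be an integer. The characteristic polynomial of the adjacency matrix of the complete bridge graph $B_{m,m-1}$ is $$\phi(A(B_{m,m-1}),x) = \bigl(x^3+(3-m)x^2+(2-2m)x-2\bigr)\,\bigl(x-(m-2)\bigr)\,(x+1)^{2m-5}.$$
   Context: For a simple graph $\Gamma$, $A(\Gamma)$ denotes its adjacency matrix, and for a square matrix $A$, $\phi(A,x)=\det(xI-A)$ is its characteristic polynomial. The complete bridge graph $B_{m,n}$ is the graph on $m+n$ vertices consisting of two vertex-disjoint complete graphs $K_m$ and $K_n$ joined by exactly one additional edge (between one vertex of $K_m$ and one vertex of $K_n$). *)

theory Defs
  imports "Graph_Theory.Graph_Theory" "Jordan_Normal_Form.Char_Poly"
begin

text \<open>Simple graphs are, as in the library locale \<^locale>\<open>graph\<close>, finite loop-free symmetric digraphs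
  without parallel arcs: an undirected edge is a pair of opposite arcs.\<close>

text \<open>The list \<open>vs\<close> fixes the order in which the vertices index the rows and columns.\<close>

definition adjacency_matrix :: "('a, 'b) pre_digraph \<Rightarrow> 'a list \<Rightarrow> real mat" where
  "adjacency_matrix G vs =
     mat (length vs) (length vs) (\<lambda>(i, j). if vs ! i \<rightarrow>\<^bsub>G\<^esub> vs ! j then 1 else 0)"

text \<open>A predicate, so that it covers every graph isomorphic to \<open>B\<^bsub>m,n\<^esub>\<close>.
  The single additional edge is the pair of arcs between \<open>u\<close> and \<open>v\<close>.\<close>

definition complete_bridge_graph :: "nat \<Rightarrow> nat \<Rightarrow> ('a, 'b) pre_digraph \<Rightarrow> bool" where
  "complete_bridge_graph m n G \<longleftrightarrow> graph G \<and>
     (\<exists>H K u v. subgraph H G \<and> subgraph K G \<and> complete_digraph m H \<and> complete_digraph n K \<and>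
        verts H \<inter> verts K = {} \<and> verts G = verts H \<union> verts K \<and>
        u \<in> verts H \<and> v \<in> verts K \<and>
        arcs_ends G = arcs_ends H \<union> arcs_ends K \<union> {(u, v), (v, u)})"

end

theory Submission
  imports Defs
begin

text \<open>
  Let \<open>A\<close> be the adjacency matrix of the bridge graph made of complete graphs on \<open>H\<close> and \<open>K\<close> with
  \<open>m\<close> and \<open>n\<close> vertices, and let \<open>u \<in> H\<close>, \<open>v \<in> K\<close> be the ends of the bridge. Filling the diagonal
  turns the two complete graphs into blocks of ones, so \<open>A + I\<close> has rank at most four: it is
  the sum of the products \<open>1\<^sub>S 1\<^sub>T\<^sup>t\<close> of indicator vectors, for \<open>(S, T)\<close> running through
  \<open>(H, H)\<close>, \<open>(K, K)\<close>, \<open>({u}, {v})\<close>, \<open>({v}, {u})\<close>. Thus \<open>A + I = U V\<close> where the columns of \<open>U\<close> are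
  the vectors \<open>1\<^sub>S\<close> and the rows of \<open>V\<close> are the vectors \<open>1\<^sub>T\<close>.

  With \<open>y = x + 1\<close>, the characteristic polynomial of \<open>A\<close> is \<open>det (y I - U V)\<close>. Exchanging the two
  factors changes this determinant only by a power of \<open>y\<close>
  (\<open>det_smult_one_minus_mult_swap\<close>), and \<open>V U\<close> is a 4-by-4 matrix whose entries are the
  cardinalities of the sets \<open>T \<inter> S\<close> (\<open>char_poly_sum_of_set_products\<close>). No ordering
  of the vertices has to be chosen, because these cardinalities do not depend on one. The small
  determinant (\<open>det_bridge_quotient\<close>) is
  \<open>(y - m) (y - n) y\<^sup>2 - (y - m + 1) (y - n + 1)\<close>.

  For \<open>n = m - 1\<close> we have \<open>y - m + 1 = y - n\<close>, so the factor \<open>y - n = x - (m - 2)\<close> splits off and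
  leaves
  \<open>(y - m) y\<^sup>2 - (y - n + 1) = (y - m) (y\<^sup>2 - 1) - 2\<close>, which is the cubic in \<open>x\<close>. The
  remaining factor is \<open>y\<close> to the power \<open>m + n - 4 = 2 m - 5\<close>.
\<close>

text \<open>
  The Weinstein--Aronszajn identity in a form without division. Multiplying
  \<open>M = (y I, U; V, I)\<close> on the right by \<open>(I, 0; - V, I)\<close> clears its lower left block and
  leaves \<open>y I - U V\<close> in the upper left; multiplying it on the left by \<open>(I, 0; - V, y I)\<close> clears the
  same block and leaves \<open>y I - V U\<close> in the lower right. The second multiplier has determinant
  \<open>y ^ k\<close>, which is where the power on the left-hand side comes from.
\<close>

lemma det_smult_one_minus_mult_swap:
  fixes U V :: "'a :: idom mat"
  assumes U: "U \<in> carrier_mat n k" and V: "V \<in> carrier_mat k n"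
  shows "y ^ k * det (y \<cdot>\<^sub>m 1\<^sub>m n - U * V) = y ^ n * det (y \<cdot>\<^sub>m 1\<^sub>m k - V * U)"
proof -
  define M where "M = four_block_mat (y \<cdot>\<^sub>m 1\<^sub>m n) U V (1\<^sub>m k)"
  have M: "M \<in> carrier_mat (n + k) (n + k)"
    using U V by (simp add: M_def)
  have UV: "y \<cdot>\<^sub>m 1\<^sub>m n - U * V \<in> carrier_mat n n"
    and VU: "y \<cdot>\<^sub>m 1\<^sub>m k - V * U \<in> carrier_mat k k"
    using U V by auto
  let ?R = "four_block_mat (1\<^sub>m n) (0\<^sub>m n k) (- V) (1\<^sub>m k)"
  let ?L = "four_block_mat (1\<^sub>m n) (0\<^sub>m n k) (- V) (y \<cdot>\<^sub>m 1\<^sub>m k)"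
  have "M * ?R = four_block_mat (y \<cdot>\<^sub>m 1\<^sub>m n - U * V) U (0\<^sub>m k n) (1\<^sub>m k)"
    unfolding M_def
    by (subst mult_four_block_mat[of _ n n _ k _ k _ _ n _ k])
      (use U V in \<open>auto intro!: cong_four_block_mat eq_matI\<close>)
  moreover have "det ?R = 1"
    using V by (subst det_four_block_mat_upper_right_zero[of _ n _ k]) auto
  ultimately have right: "det M = det (y \<cdot>\<^sub>m 1\<^sub>m n - U * V)"
    using det_mult[OF M, of ?R] det_four_block_mat_lower_left_zero[OF UV U refl one_carrier_mat] V
    by simp
  have "?L * M = four_block_mat (y \<cdot>\<^sub>m 1\<^sub>m n) U (0\<^sub>m k n) (y \<cdot>\<^sub>m 1\<^sub>m k - V * U)"
    unfolding M_def
    by (subst mult_four_block_mat[of _ n n _ k _ k _ _ n _ k])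
      (use U V in \<open>auto intro!: cong_four_block_mat eq_matI\<close>)
  moreover have "det ?L = y ^ k"
    using V by (subst det_four_block_mat_upper_right_zero[of _ n _ k]) auto
  ultimately have "y ^ k * det M = y ^ n * det (y \<cdot>\<^sub>m 1\<^sub>m k - V * U)"
    using det_mult[of ?L "n + k" M] M V
      det_four_block_mat_lower_left_zero[of "y \<cdot>\<^sub>m 1\<^sub>m n" n, OF _ U refl VU]
    by simp
  then show ?thesis
    by (simp add: right)
qed

text \<open>
  If \<open>A + I\<close> is a sum of products of indicator vectors, the exchange identity at
  \<open>y = x + 1\<close>, over the ring of polynomials, replaces \<open>A\<close> by a matrix whose size is the number of
  summands. An entry of that matrix is a scalar product of two indicator vectors and hence counts
  an intersection.
\<close>

lemma char_poly_sum_of_set_products: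
  fixes A :: "real mat" and S T :: "nat \<Rightarrow> 'a set"
  assumes A: "A \<in> carrier_mat (length vs) (length vs)"
    and vs: "distinct vs" and S: "\<And>l. l < k \<Longrightarrow> S l \<subseteq> set vs"
    and entries: "\<And>i j. i < length vs \<Longrightarrow> j < length vs \<Longrightarrow>
      A $$ (i, j) + of_bool (i = j) = (\<Sum>l<k. of_bool (vs ! i \<in> S l) * of_bool (vs ! j \<in> T l))"
  shows "[:1, 1:] ^ k * char_poly A =
    [:1, 1:] ^ length vs * det (mat k k (\<lambda>(i, j).
      of_bool (i = j) * [:1, 1:] - of_nat (card (T i \<inter> S j))))"
proof -
  let ?n = "length vs"
  let ?y = "[:1, 1:] :: real poly"
  define U :: "real poly mat" where "U = mat ?n k (\<lambda>(i, l). of_bool (vs ! i \<in> S l))"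
  define V :: "real poly mat" where "V = mat k ?n (\<lambda>(l, j). of_bool (vs ! j \<in> T l))"
  have U: "U \<in> carrier_mat ?n k" and V: "V \<in> carrier_mat k ?n"
    by (auto simp: U_def V_def)
  have "char_poly_matrix A = ?y \<cdot>\<^sub>m 1\<^sub>m ?n - U * V"
  proof (rule eq_matI)
    fix i j
    assume "i < dim_row (?y \<cdot>\<^sub>m 1\<^sub>m ?n - U * V)" "j < dim_col (?y \<cdot>\<^sub>m 1\<^sub>m ?n - U * V)"
    then have ij: "i < ?n" "j < ?n"
      using U V by auto
    have "(U * V) $$ (i, j) = [:\<Sum>l<k. of_bool (vs ! i \<in> S l) * of_bool (vs ! j \<in> T l):]"
      using ij by (simp add: U_def V_def scalar_prod_def lessThan_atLeast0 of_nat_poly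
          flip: of_bool_conj)
    then have "(U * V) $$ (i, j) = [:A $$ (i, j) + of_bool (i = j):]"
      using entries[OF ij] by simp
    then show "char_poly_matrix A $$ (i, j) = (?y \<cdot>\<^sub>m 1\<^sub>m ?n - U * V) $$ (i, j)"
      using ij A U V by (auto simp: char_poly_matrix_def)
  qed (use A U V in \<open>auto simp: char_poly_matrix_def\<close>)
  moreover have "?y \<cdot>\<^sub>m 1\<^sub>m k - V * U = mat k k (\<lambda>(i, j).
      of_bool (i = j) * ?y - of_nat (card (T i \<inter> S j)))"
  proof (rule eq_matI)
    fix i j
    assume "i < dim_row (mat k k (\<lambda>(i, j). of_bool (i = j) * ?y - of_nat (card (T i \<inter> S j))))"
      "j < dim_col (mat k k (\<lambda>(i, j). of_bool (i = j) * ?y - of_nat (card (T i \<inter> S j))))"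
    then have ij: "i < k" "j < k"
      by auto
    have "(V * U) $$ (i, j) = (\<Sum>p<?n. of_bool (vs ! p \<in> T i \<inter> S j))"
      using ij by (simp add: U_def V_def scalar_prod_def lessThan_atLeast0 of_bool_conj)
    also have "\<dots> = (\<Sum>w\<in>set vs. of_bool (w \<in> T i \<inter> S j))"
      by (rule sum.reindex_bij_betw[OF bij_betw_nth[OF vs refl refl]])
    also have "\<dots> = of_nat (card (T i \<inter> S j))"
      using S[OF ij(2)] by (simp add: sum_of_bool_eq Int_absorb1 inf.coboundedI2 Collect_conj_eq)
    finally show "(?y \<cdot>\<^sub>m 1\<^sub>m k - V * U) $$ (i, j) =
        mat k k (\<lambda>(i, j). of_bool (i = j) * ?y - of_nat (card (T i \<inter> S j))) $$ (i, j)"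
      using ij U V by auto
  qed (use U V in auto)
  ultimately show ?thesis
    using det_smult_one_minus_mult_swap[OF U V, of ?y] by (simp add: char_poly_def)
qed

lemma det_2x2:
  fixes A :: "'a :: comm_ring_1 mat"
  assumes "A \<in> carrier_mat 2 2"
  shows "det A = A $$ (0, 0) * A $$ (1, 1) - A $$ (0, 1) * A $$ (1, 0)"
proof -
  have "det (mat_delete A 0 j) = mat_delete A 0 j $$ (0, 0)" if "j < 2" for j
    using assms that by (intro det_single) (auto simp: mat_delete_def)
  then show ?thesis
    using assms by (subst laplace_expansion_row[OF assms, of 0])
      (auto simp: numeral_2_eq_2 cofactor_def mat_delete_def)
qed

text \<open>
  This block matrix is \<open>y I - V U\<close> for the bridge graph, with \<open>a\<close> and \<open>b\<close> the sizes of the two complete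
  graphs. The lower blocks \<open>C\<close> and \<open>D\<close> commute since \<open>D = y I + C\<close>, so the determinant of the
  block matrix is that of the 2-by-2 matrix \<open>A D + C\<close>.
\<close>

lemma det_bridge_quotient:
  fixes y a b :: "'a :: idom"
  defines "A \<equiv> mat_of_rows_list 2 [[y - a, 0], [0, y - b]]"
    and "C \<equiv> mat_of_rows_list 2 [[0, -1], [-1, 0]]"
    and "D \<equiv> mat_of_rows_list 2 [[y, -1], [-1, y]]"
  shows "det (four_block_mat A (- 1\<^sub>m 2) C D) =
    (y - a) * (y - b) * y ^ 2 - (y - a + 1) * (y - b + 1)"
proof -
  have carrier: "A \<in> carrier_mat 2 2" "C \<in> carrier_mat 2 2" "D \<in> carrier_mat 2 2"
    by (auto simp: A_def C_def D_def mat_of_rows_list_def)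
  have two: "l < Suc (Suc 0) \<longleftrightarrow> l = 0 \<or> l = 1" "l < 2 \<longleftrightarrow> l = 0 \<or> l = 1" for l :: nat
    by auto
  have "C * D = D * C"
    by (rule eq_matI) (auto simp: C_def D_def mat_of_rows_list_def scalar_prod_def two)
  then have "det (four_block_mat A (- 1\<^sub>m 2) C D) = det (A * D - (- 1\<^sub>m 2) * C)"
    using carrier by (intro det_four_block_mat) auto
  also have "A * D - (- 1\<^sub>m 2) * C = mat_of_rows_list 2
      [[(y - a) * y, - (y - a + 1)], [- (y - b + 1), (y - b) * y]]"
    using carrier by (intro eq_matI)
      (auto simp: A_def C_def D_def mat_of_rows_list_def scalar_prod_def two algebra_simps)
  also have "det \<dots> = (y - a) * (y - b) * y ^ 2 - (y - a + 1) * (y - b + 1)"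
    by (subst det_2x2) (auto simp: mat_of_rows_list_def algebra_simps power2_eq_square)
  finally show ?thesis .
qed

text \<open>
  The factor \<open>y ^ 4\<close> stays on the left so that the formula covers also the graphs with fewer
  than four vertices.
\<close>

lemma char_poly_complete_bridge_graph:
  fixes G :: "('a, 'b) pre_digraph"
  assumes G: "complete_bridge_graph m n G" and vs: "distinct vs" "set vs = verts G"
  defines "y \<equiv> [:1, 1:] :: real poly"
  shows "y ^ 4 * char_poly (adjacency_matrix G vs) =
    y ^ (m + n) * ((y - of_nat m) * (y - of_nat n) * y ^ 2
      - (y - of_nat m + 1) * (y - of_nat n + 1))"
proof -
  obtain H K :: "('a, 'b) pre_digraph" and u v
    where H: "complete_digraph m H" and K: "complete_digraph n K"
    and disj: "verts H \<inter> verts K = {}" and verts: "verts G = verts H \<union> verts K"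
    and u: "u \<in> verts H" and v: "v \<in> verts K"
    and ends: "arcs_ends G = arcs_ends H \<union> arcs_ends K \<union> {(u, v), (v, u)}"
    using G unfolding complete_bridge_graph_def by blast
  have card: "card (verts H) = m" "card (verts K) = n"
    using H K by (auto simp: complete_digraph_def)
  have fin: "finite (verts H)" "finite (verts K)"
    using vs(2) verts by (metis List.finite_set finite_Un)+
  have len: "length vs = m + n"
    using distinct_card[OF vs(1)] vs(2) verts card disj fin by (simp add: card_Un_disjoint)
  \<comment> \<open>The bridge contributes the two arcs \<open>(u, v)\<close> and \<open>(v, u)\<close>, hence the swap in the last two sets.\<close>
  define S where "S l = [verts H, verts K, {u}, {v}] ! l" for l
  define T where "T l = [verts H, verts K, {v}, {u}] ! l" for l
  have ne: "u \<noteq> v" "u \<notin> verts K" "v \<notin> verts H"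
    using u v disj by auto
  have four: "l < 4 \<longleftrightarrow> l = 0 \<or> l = 1 \<or> l = 2 \<or> l = 3" for l :: nat
    by auto
  have "y ^ 4 * char_poly (adjacency_matrix G vs) = y ^ length vs * det (mat 4 4 (\<lambda>(i, j).
      of_bool (i = j) * y - of_nat (card (T i \<inter> S j))))"
    unfolding y_def
  proof (rule char_poly_sum_of_set_products)
    fix i j
    assume ij: "i < length vs" "j < length vs"
    define a b where "a = vs ! i" and "b = vs ! j"
    have "a \<in> verts H \<union> verts K" "b \<in> verts H \<union> verts K"
      using ij vs(2) verts by (metis a_def b_def nth_mem)+
    moreover have eq: "i = j \<longleftrightarrow> a = b"
      using ij vs(1) by (simp add: nth_eq_iff_index_eq a_def b_def)
    moreover have "(a, b) \<in> arcs_ends G \<longleftrightarrow>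
        a \<noteq> b \<and> (a \<in> verts H \<and> b \<in> verts H \<or> a \<in> verts K \<and> b \<in> verts K)
        \<or> a = u \<and> b = v \<or> a = v \<and> b = u"
      using H K by (auto simp: ends complete_digraph_def)
    ultimately have "of_bool ((a, b) \<in> arcs_ends G) + of_bool (a = b) =
        of_bool (a \<in> verts H) * of_bool (b \<in> verts H)
        + of_bool (a \<in> verts K) * of_bool (b \<in> verts K)
        + of_bool (a = u) * of_bool (b = v) + of_bool (a = v) * (of_bool (b = u) :: real)"
      using disj u v ne
      by (cases "a \<in> verts H"; cases "b \<in> verts H"; cases "a = b"; simp add: disjoint_iff) auto
    with eq show "adjacency_matrix G vs $$ (i, j) + of_bool (i = j) =
        (\<Sum>l<4. of_bool (vs ! i \<in> S l) * of_bool (vs ! j \<in> T l))"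
      using ij by (simp add: adjacency_matrix_def of_bool_def S_def T_def a_def b_def
          eval_nat_numeral split del: if_split)
  qed (use vs verts u v in \<open>auto simp: adjacency_matrix_def S_def four\<close>)
  also have "mat 4 4 (\<lambda>(i, j). of_bool (i = j) * y - of_nat (card (T i \<inter> S j))) =
      four_block_mat (mat_of_rows_list 2 [[y - of_nat m, 0], [0, y - of_nat n]]) (- 1\<^sub>m 2)
        (mat_of_rows_list 2 [[0, -1], [-1, 0]]) (mat_of_rows_list 2 [[y, -1], [-1, y]])"
    (is "?Q = ?B")
  proof (rule eq_matI)
    fix i j
    assume "i < dim_row ?B" "j < dim_col ?B"
    then have "i < 4" "j < 4"
      by (auto simp: mat_of_rows_list_def)
    moreover have "verts K \<inter> verts H = {}"
      using disj by auto
    ultimately show "?Q $$ (i, j) = ?B $$ (i, j)"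
      using disj u v ne card unfolding four
      by (elim disjE) (simp_all add: S_def T_def mat_of_rows_list_def)
  qed (auto simp: mat_of_rows_list_def)
  finally show ?thesis
    by (simp add: det_bridge_quotient len)
qed

theorem theorem3p7:
  fixes m :: nat and G :: "('a, 'b) pre_digraph" and vs :: "'a list"
  assumes "m > 2"
    and "complete_bridge_graph m (m - 1) G"
    and "distinct vs" and "set vs = verts G"
  shows "char_poly (adjacency_matrix G vs) =
    [:- 2, 2 - 2 * real m, 3 - real m, 1:] * [:- (real m - 2), 1:] * [:1, 1:] ^ (2 * m - 5)"
proof -
  let ?y = "[:1, 1:] :: real poly"
  have "(?y - of_nat m) * (?y - of_nat (m - 1)) * ?y ^ 2
      - (?y - of_nat m + 1) * (?y - of_nat (m - 1) + 1) =
      [:- 2, 2 - 2 * real m, 3 - real m, 1:] * [:- (real m - 2), 1:]"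
    using \<open>m > 2\<close>
    by (simp add: of_nat_poly one_pCons power2_eq_square of_nat_diff algebra_simps)
  \<comment> \<open>The subtraction on the right does not truncate, since \<open>m > 2\<close> gives \<open>2 * m \<ge> 6\<close>.\<close>
  moreover have "m + (m - 1) = 4 + (2 * m - 5)"
    using \<open>m > 2\<close> by simp
  then have "?y ^ (m + (m - 1)) = ?y ^ 4 * ?y ^ (2 * m - 5)"
    by (simp only: power_add)
  ultimately have "?y ^ 4 * char_poly (adjacency_matrix G vs) = ?y ^ 4 *
      ([:- 2, 2 - 2 * real m, 3 - real m, 1:] * [:- (real m - 2), 1:] * ?y ^ (2 * m - 5))"
    using char_poly_complete_bridge_graph[OF assms(2-4)] by (simp only: ac_simps)
  then show ?thesis
    by (simp only: mult_cancel_left) simp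
qed

end
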